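(* Let $\mathcal H(s,p)$ be a smooth function on an open subset $U$ of $\{(s,p): s>p>0\}$ satisfying $$\mathcal H_s^2+\frac{2s}{p}\mathcal H_s\mathcal H_p+\mathcal H_p^2=1 .$$ Let $\tau_1,\tau_2:U\to\mathbb R$ be the functions $$\tau_1=6\left(s\mathcal H_s+p\mathcal H_p-\mathcal H\right),$$ $$\tau_2=6\mathcal H^2-2p^2-12p\mathcal H\mathcal H_p+8p^2\mathcal H_p^2+4s\mathcal H_s\left(4p\mathcal H_p-3\mathcal H\right)-4\left(p^2-3s^2\right)\mathcal H_s^2$$ (these are the two Lorentz scalars $T^\mu{}_\mu$ and $T^{\mu\nu}T_{\mu\nu}$ of the energy-momentum tensor of the corresponding six-dimensional chiral two-form theory). Then every function $\mathcal O(s,p)=f(\tau_1(s,p),\tau_2(s,p))$, with $f$ smooth, satisfies $$\mathcal H_s\mathcal O_s+\frac sp\left(\mathcal H_p\mathcal O_s+\mathcal H_s\mathcal O_p\right)+\mathcal H_p\mathcal O_p=0 ,$$ i.e. the deformation $\mathcal H\to\mathcal H+\lambda\mathcal O$ preserves the displayed equation on $\mathcal H$ to leading order in $\lambda$.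
   Context: Subscripts $s,p$ denote partial derivatives. The displayed first-order PDE on $\mathcal H$ is the condition for Lorentz (equivalently PST gauge) invariance of the chiral two-form theory with Hamiltonian density $\mathcal H(s,p)$. *)

theory Defs
  imports "HOL-Analysis.Analysis" "HOL-Library.Landau_Symbols"
begin

(* C^n and C^infinity via iterated directional derivatives; meant for open S. *)
primrec Ck_on :: "nat \<Rightarrow> 'a::real_normed_vector set \<Rightarrow> ('a \<Rightarrow> 'b::real_normed_vector) \<Rightarrow> bool" where
  "Ck_on 0 S f \<longleftrightarrow> continuous_on S f"
| "Ck_on (Suc n) S f \<longleftrightarrow>
     (\<forall>x\<in>S. f differentiable (at x)) \<and>
     (\<forall>v. Ck_on n S (\<lambda>x. frechet_derivative f (at x) v))"

definition smooth_on :: "'a::real_normed_vector set \<Rightarrow> ('a \<Rightarrow> 'b::real_normed_vector) \<Rightarrow> bool" where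
  "smooth_on S f \<longleftrightarrow> (\<forall>n. Ck_on n S f)"

definition partial_s :: "(real \<times> real \<Rightarrow> real) \<Rightarrow> real \<times> real \<Rightarrow> real" where
  "partial_s F = (\<lambda>(s, p). deriv (\<lambda>x. F (x, p)) s)"

definition partial_p :: "(real \<times> real \<Rightarrow> real) \<Rightarrow> real \<times> real \<Rightarrow> real" where
  "partial_p F = (\<lambda>(s, p). deriv (\<lambda>y. F (s, y)) p)"

(* Lorentz invariance of the theory with Hamiltonian density H is lorentz_form H = 1. *)
definition lorentz_form :: "(real \<times> real \<Rightarrow> real) \<Rightarrow> real \<times> real \<Rightarrow> real" where
  "lorentz_form H = (\<lambda>(s, p).
     (partial_s H (s, p))\<^sup>2
     + 2 * s / p * partial_s H (s, p) * partial_p H (s, p)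
     + (partial_p H (s, p))\<^sup>2)"

(* The trace of the energy-momentum tensor of the six-dimensional theory. *)
definition tau1 :: "(real \<times> real \<Rightarrow> real) \<Rightarrow> real \<times> real \<Rightarrow> real" where
  "tau1 H = (\<lambda>(s, p). 6 * (s * partial_s H (s, p) + p * partial_p H (s, p) - H (s, p)))"

(* The full contraction of the energy-momentum tensor with itself. *)
definition tau2 :: "(real \<times> real \<Rightarrow> real) \<Rightarrow> real \<times> real \<Rightarrow> real" where
  "tau2 H = (\<lambda>(s, p).
     6 * (H (s, p))\<^sup>2 - 2 * p\<^sup>2
     - 12 * p * H (s, p) * partial_p H (s, p)
     + 8 * p\<^sup>2 * (partial_p H (s, p))\<^sup>2
     + 4 * s * partial_s H (s, p) * (4 * p * partial_p H (s, p) - 3 * H (s, p))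
     - 4 * (p\<^sup>2 - 3 * s\<^sup>2) * (partial_s H (s, p))\<^sup>2)"

end

theory Submission
  imports Defs
begin

text \<open>The linearised equation says that \<open>\<O>\<close> is constant along the vector field
  \<open>v = (H\<^sub>s + (s/p) H\<^sub>p, (s/p) H\<^sub>s + H\<^sub>p)\<close>. The equation on \<open>H\<close> itself reads \<open>v(H) = 1\<close>, and its
  two partial derivatives, by symmetry of the mixed derivatives, read \<open>v(H\<^sub>s) = - H\<^sub>s H\<^sub>p / p\<close> and
  \<open>v(H\<^sub>p) = s H\<^sub>s H\<^sub>p / p\<^sup>2\<close>. With these three values, \<open>v(\<tau>\<^sub>1) = v(\<tau>\<^sub>2) = 0\<close> is an algebraic identity.\<close>

section \<open>Symmetry of mixed partial derivatives\<close>

text \<open>Two applications of the mean value theorem: first to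
  \<open>t \<mapsto> F (t, y + h) - F (t, y)\<close>, then to \<open>a (u, _)\<close>. The left-hand
  side is symmetric in the two variables, which drives the comparison of mixed derivatives.\<close>

lemma second_difference_mvt:
  fixes F a c :: "real \<times> real \<Rightarrow> real"
  assumes h: "h > 0"
    and a: "\<And>u w. x \<le> u \<Longrightarrow> u \<le> x + h \<Longrightarrow> y \<le> w \<Longrightarrow> w \<le> y + h \<Longrightarrow>
      ((\<lambda>t. F (t, w)) has_real_derivative a (u, w)) (at u)"
    and c: "\<And>u w. x \<le> u \<Longrightarrow> u \<le> x + h \<Longrightarrow> y \<le> w \<Longrightarrow> w \<le> y + h \<Longrightarrow>
      ((\<lambda>t. a (u, t)) has_real_derivative c (u, w)) (at w)"
  obtains u w where "x < u" "u < x + h" "y < w" "w < y + h"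
    "F (x + h, y + h) - F (x, y + h) - F (x + h, y) + F (x, y) = h\<^sup>2 * c (u, w)"
proof -
  have "\<exists>u. x < u \<and> u < x + h \<and>
      (F (x + h, y + h) - F (x + h, y)) - (F (x, y + h) - F (x, y))
        = (x + h - x) * (a (u, y + h) - a (u, y))"
    using h by (intro MVT2[where f = "\<lambda>t. F (t, y + h) - F (t, y)"] DERIV_diff a) auto
  then obtain u where u: "x < u" "u < x + h"
    and ueq: "(F (x + h, y + h) - F (x + h, y)) - (F (x, y + h) - F (x, y))
        = h * (a (u, y + h) - a (u, y))" by auto
  have "\<exists>w. y < w \<and> w < y + h \<and> a (u, y + h) - a (u, y) = (y + h - y) * c (u, w)"
    using h u by (intro MVT2[where f = "\<lambda>t. a (u, t)"] c) auto
  then obtain w where "y < w" "w < y + h" "a (u, y + h) - a (u, y) = h * c (u, w)" by auto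
  with u ueq show ?thesis by (intro that[of u w]) (auto simp: power2_eq_square)
qed

text \<open>The second difference over a small square at \<open>(x, y)\<close> equals
  \<open>h\<^sup>2\<close> times a value of \<open>c\<close> and also \<open>h\<^sup>2\<close> times
  a value of \<open>d\<close>. As the square shrinks, continuity at \<open>(x, y)\<close> forces the
  two limits to agree.\<close>

lemma mixed_partials_commute:
  fixes F a b c d :: "real \<times> real \<Rightarrow> real"
  assumes U: "open U" "(x, y) \<in> U"
    and a: "\<And>u w. (u, w) \<in> U \<Longrightarrow> ((\<lambda>t. F (t, w)) has_real_derivative a (u, w)) (at u)"
    and b: "\<And>u w. (u, w) \<in> U \<Longrightarrow> ((\<lambda>t. F (u, t)) has_real_derivative b (u, w)) (at w)"
    and c: "\<And>u w. (u, w) \<in> U \<Longrightarrow> ((\<lambda>t. a (u, t)) has_real_derivative c (u, w)) (at w)"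
    and d: "\<And>u w. (u, w) \<in> U \<Longrightarrow> ((\<lambda>t. b (t, w)) has_real_derivative d (u, w)) (at u)"
    and cont: "isCont c (x, y)" "isCont d (x, y)"
  shows "c (x, y) = d (x, y)"
proof -
  have "\<bar>c (x, y) - d (x, y)\<bar> < e" if e: "e > 0" for e
  proof -
    have "eventually (\<lambda>z. dist (c z) (c (x, y)) < e / 2) (nhds (x, y))"
      "eventually (\<lambda>z. dist (d z) (d (x, y)) < e / 2) (nhds (x, y))"
      using cont half_gt_zero[OF e] unfolding isCont_def tendsto_at_iff_tendsto_nhds
      by (blast intro: tendstoD)+
    moreover have "eventually (\<lambda>z. z \<in> U) (nhds (x, y))"
      using U by (rule eventually_nhds_in_open)
    ultimately have "eventually (\<lambda>z. z \<in> U \<and> dist (c z) (c (x, y)) < e / 2 \<and>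
        dist (d z) (d (x, y)) < e / 2) (nhds (x, y))"
      by eventually_elim simp
    then obtain \<delta> where \<delta>: "\<delta> > 0"
      and near: "\<And>z. dist z (x, y) < \<delta> \<Longrightarrow> z \<in> U \<and> dist (c z) (c (x, y)) < e / 2 \<and>
        dist (d z) (d (x, y)) < e / 2"
      unfolding eventually_nhds_metric by blast
    \<comment> \<open>The distance from \<open>(x, y)\<close> within the square of side
      \<open>h\<close> is at most \<open>2 * h\<close>, hence below \<open>\<delta>\<close>.\<close>
    define h where "h = \<delta> / 3"
    have h: "h > 0" using \<delta> by (simp add: h_def)
    have sq: "dist (u, w) (x, y) < \<delta>" if "x \<le> u" "u \<le> x + h" "y \<le> w" "w \<le> y + h" for u w
    proof -
      have "dist (u, w) (x, y) \<le> \<bar>u - x\<bar> + \<bar>w - y\<bar>"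
        unfolding dist_Pair_Pair dist_real_def
        by (metis abs_ge_zero sqrt_sum_squares_le_sum)
      with that \<delta> show ?thesis by (simp add: h_def)
    qed
    have inU: "(u, w) \<in> U" if "x \<le> u" "u \<le> x + h" "y \<le> w" "w \<le> y + h" for u w
      using near[OF sq[OF that]] by blast
    obtain u w where uw: "x < u" "u < x + h" "y < w" "w < y + h"
      and eq1: "F (x + h, y + h) - F (x, y + h) - F (x + h, y) + F (x, y) = h\<^sup>2 * c (u, w)"
      using second_difference_mvt[OF h a c, OF inU inU] by blast
    obtain w' u' where uw': "y < w'" "w' < y + h" "x < u'" "u' < x + h"
      and eq2: "F (x + h, y + h) - F (x + h, y) - F (x, y + h) + F (x, y) = h\<^sup>2 * d (u', w')"
      \<comment> \<open>The same lemma with the coordinates exchanged: \<open>b\<close> and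
        \<open>d\<close> now play the roles of \<open>a\<close> and \<open>c\<close>.\<close>
      using second_difference_mvt[OF h, of y x "\<lambda>(p, q). F (q, p)" "\<lambda>(p, q). b (q, p)"
            "\<lambda>(p, q). d (q, p)", unfolded prod.case, OF b d, OF inU inU] by blast
    have "h\<^sup>2 * c (u, w) = h\<^sup>2 * d (u', w')" using eq1 eq2 by linarith
    hence "c (u, w) = d (u', w')" using h by simp
    moreover have "dist (c (u, w)) (c (x, y)) < e / 2" "dist (d (u', w')) (d (x, y)) < e / 2"
      using near sq uw uw' by (meson less_imp_le)+
    ultimately show ?thesis unfolding dist_real_def by linarith
  qed
  \<comment> \<open>Were the values different, their distance would be an admissible
    \<open>e\<close> smaller than itself.\<close>
  from this[of "\<bar>c (x, y) - d (x, y)\<bar>"] show ?thesis by fastforce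
qed

section \<open>Partial derivatives of smooth functions\<close>

lemma has_derivative_imp_DERIV_fst:
  assumes "(F has_derivative F') (at (s, p))"
  shows "((\<lambda>x. F (x, p)) has_real_derivative F' (1, 0)) (at s)"
proof -
  have lin: "linear F'" using assms by (rule has_derivative_linear)
  have "((\<lambda>x. F (x, p)) has_derivative (\<lambda>h. F' (h, 0))) (at s)"
    by (rule has_derivative_compose[where g = F and f = "\<lambda>x. (x, p)"])
      (use assms in \<open>auto intro!: derivative_eq_intros\<close>)
  moreover have "(\<lambda>h. F' (h, 0)) = (*) (F' (1, 0))"
  proof
    fix h
    show "F' (h, 0) = F' (1, 0) * h" using linear_scale[OF lin, of h "(1, 0)"] by simp
  qed
  ultimately show ?thesis by (simp only: has_field_derivative_def)
qed

lemma has_derivative_imp_DERIV_snd: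
  assumes "(F has_derivative F') (at (s, p))"
  shows "((\<lambda>y. F (s, y)) has_real_derivative F' (0, 1)) (at p)"
proof -
  have lin: "linear F'" using assms by (rule has_derivative_linear)
  have "((\<lambda>y. F (s, y)) has_derivative (\<lambda>h. F' (0, h))) (at p)"
    by (rule has_derivative_compose[where g = F and f = "\<lambda>y. (s, y)"])
      (use assms in \<open>auto intro!: derivative_eq_intros\<close>)
  moreover have "(\<lambda>h. F' (0, h)) = (*) (F' (0, 1))"
  proof
    fix h
    show "F' (0, h) = F' (0, 1) * h" using linear_scale[OF lin, of h "(0, 1)"] by simp
  qed
  ultimately show ?thesis by (simp only: has_field_derivative_def)
qed

lemma has_derivative_imp_partials:
  assumes "(F has_derivative F') (at (s, p))"
  shows "partial_s F (s, p) = F' (1, 0)" "partial_p F (s, p) = F' (0, 1)"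
  using has_derivative_imp_DERIV_fst[OF assms] has_derivative_imp_DERIV_snd[OF assms]
  by (auto simp: partial_s_def partial_p_def intro: DERIV_imp_deriv)

lemma linear_pair_expand:
  fixes F' :: "real \<times> real \<Rightarrow> real"
  assumes "linear F'"
  shows "F' (u, w) = u * F' (1, 0) + w * F' (0, 1)"
proof -
  have "F' (u, w) = F' (u *\<^sub>R (1, 0) + w *\<^sub>R (0, 1))" by simp
  also have "\<dots> = u * F' (1, 0) + w * F' (0, 1)"
    by (simp only: linear_add[OF assms] linear_scale[OF assms] real_scaleR_def)
  finally show ?thesis .
qed

text \<open>Links the one-variable \<open>deriv\<close> behind \<open>partial_s\<close> and
  \<open>partial_p\<close> to total derivatives, so that later computations can use the chain rule
  and uniqueness of derivatives.\<close>

lemma has_derivative_partials: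
  fixes F :: "real \<times> real \<Rightarrow> real"
  assumes "F differentiable at z"
  shows "(F has_derivative (\<lambda>v. fst v * partial_s F z + snd v * partial_p F z)) (at z)"
proof -
  obtain s p where z: "z = (s, p)" by force
  from assms obtain F' where F': "(F has_derivative F') (at (s, p))"
    unfolding differentiable_def z by blast
  have "F' = (\<lambda>v. fst v * partial_s F z + snd v * partial_p F z)"
  proof
    fix v :: "real \<times> real"
    show "F' v = fst v * partial_s F z + snd v * partial_p F z"
      using linear_pair_expand[OF has_derivative_linear[OF F'], of "fst v" "snd v"]
      by (simp add: has_derivative_imp_partials[OF F'] z)
  qed
  with F' show ?thesis by (simp add: z)
qed

text \<open>On an open set, functions that agree there have the same Frechet derivatives there, so
  the agreement passes down the recursion.\<close>

lemma Ck_on_cong: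
  assumes "open S" "\<And>x. x \<in> S \<Longrightarrow> f x = g x" "Ck_on n S f"
  shows "Ck_on n S g"
  using assms(2,3)
proof (induction n arbitrary: f g)
  case 0
  have "continuous_on S f" using "0.prems"(2) by simp
  hence "continuous_on S g" by (rule continuous_on_eq) (rule "0.prems"(1))
  thus ?case by simp
next
  case (Suc n)
  have f: "f differentiable at x" if "x \<in> S" for x
    using Suc.prems(2) that by simp
  have "g differentiable at x" if x: "x \<in> S" for x
  proof -
    obtain f' where "(f has_derivative f') (at x)"
      using f[OF x] unfolding differentiable_def by blast
    hence "(g has_derivative f') (at x)"
      by (rule has_derivative_transform_within_open[OF _ assms(1) x]) (rule Suc.prems(1))
    thus ?thesis unfolding differentiable_def by blast
  qed
  moreover have fg: "frechet_derivative f (at x) = frechet_derivative g (at x)" if "x \<in> S" for x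
    by (rule frechet_derivative_transform_within_open[OF f[OF that] assms(1) that])
      (rule Suc.prems(1))
  have "Ck_on n S (\<lambda>x. frechet_derivative g (at x) v)" for v
  proof (rule Suc.IH)
    show "frechet_derivative f (at x) v = frechet_derivative g (at x) v" if "x \<in> S" for x
      by (simp only: fg[OF that])
    show "Ck_on n S (\<lambda>x. frechet_derivative f (at x) v)" using Suc.prems(2) by simp
  qed
  ultimately show ?case by (simp only: Ck_on.simps) blast
qed

lemma smooth_on_imp_differentiable:
  assumes "smooth_on S f" "x \<in> S"
  shows "f differentiable at x"
proof -
  have "Ck_on (Suc 0) S f" using assms(1) unfolding smooth_on_def by blast
  thus ?thesis using assms(2) by simp
qed

lemma smooth_on_imp_isCont:
  assumes "smooth_on S f" "x \<in> S"
  shows "isCont f x"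
  using smooth_on_imp_differentiable[OF assms] by (rule differentiable_imp_continuous_within)

text \<open>Each order of \<open>g\<close> costs one order of \<open>f\<close>, which is harmless
  when all orders are available. Agreement is asked only on \<open>S\<close>, where the partial
  derivatives are known to be directional derivatives.\<close>

lemma smooth_on_directional_derivative:
  assumes "open S" "smooth_on S f" "\<And>x. x \<in> S \<Longrightarrow> g x = frechet_derivative f (at x) v"
  shows "smooth_on S g"
proof -
  have "Ck_on n S g" for n
  proof (rule Ck_on_cong[OF assms(1)])
    have "Ck_on (Suc n) S f" using assms(2) unfolding smooth_on_def by blast
    thus "Ck_on n S (\<lambda>x. frechet_derivative f (at x) v)" by simp
  qed (simp add: assms(3))
  thus ?thesis unfolding smooth_on_def by blast
qed

lemma smooth_on_partials:
  assumes "open S" "smooth_on S F"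
  shows "smooth_on S (partial_s F)" "smooth_on S (partial_p F)"
proof -
  have "partial_s F z = frechet_derivative F (at z) (1, 0)"
    "partial_p F z = frechet_derivative F (at z) (0, 1)" if "z \<in> S" for z
    using frechet_derivative_at[OF has_derivative_partials[OF
          smooth_on_imp_differentiable[OF assms(2) that]], symmetric] by simp_all
  thus "smooth_on S (partial_s F)" "smooth_on S (partial_p F)"
    by (blast intro: smooth_on_directional_derivative[OF assms])+
qed

lemma partial_s_partial_p_commute:
  assumes "open U" "smooth_on U F" "z \<in> U"
  shows "partial_p (partial_s F) z = partial_s (partial_p F) z"
proof -
  obtain s p where z: "z = (s, p)" by force
  have ds: "((\<lambda>t. G (t, w)) has_real_derivative partial_s G (u, w)) (at u)"
    and dp: "((\<lambda>t. G (u, t)) has_real_derivative partial_p G (u, w)) (at w)"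
    if "smooth_on U G" "(u, w) \<in> U" for G u w
    using has_derivative_imp_DERIV_fst[OF has_derivative_partials[OF
          smooth_on_imp_differentiable[OF that]]]
      has_derivative_imp_DERIV_snd[OF has_derivative_partials[OF
          smooth_on_imp_differentiable[OF that]]] by simp_all
  note sm = smooth_on_partials[OF assms(1)]
  show ?thesis unfolding z
    by (rule mixed_partials_commute[OF assms(1) assms(3)[unfolded z]])
      (use assms(2,3) sm[OF assms(2)] sm(1)[OF sm(2)[OF assms(2)]] sm(2)[OF sm(1)[OF assms(2)]] z
        in \<open>auto intro!: ds dp smooth_on_imp_isCont[of U]\<close>)
qed

section \<open>The flow of the linearised equation\<close>

text \<open>As a quadratic form in \<open>(a, b)\<close>, the Lorentz form has half-gradient
  \<open>(X, Y)\<close>. Differentiating it therefore produces derivatives weighted by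
  \<open>X\<close> and \<open>Y\<close>, and the right-hand sides come from the explicit coefficient
  \<open>s / p\<close>.\<close>

lemma lorentz_flow_derivatives:
  fixes s p :: real
  assumes U: "open U" "(s, p) \<in> U" and p: "p \<noteq> 0"
    and H: "smooth_on U H" and eq: "\<And>z. z \<in> U \<Longrightarrow> lorentz_form H z = 1"
  defines "a \<equiv> partial_s H (s, p)" and "b \<equiv> partial_p H (s, p)"
  defines "X \<equiv> a + s / p * b" and "Y \<equiv> s / p * a + b"
  shows "X * partial_s (partial_s H) (s, p) + Y * partial_p (partial_s H) (s, p) = - (a * b / p)"
    and "X * partial_s (partial_p H) (s, p) + Y * partial_p (partial_p H) (s, p) = s * a * b / p\<^sup>2"
proof -
  note sm = smooth_on_partials[OF U(1) H]
  note da = has_derivative_partials[OF smooth_on_imp_differentiable[OF sm(1) U(2)]]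
  note db = has_derivative_partials[OF smooth_on_imp_differentiable[OF sm(2) U(2)]]
  define A B C where "A = partial_s (partial_s H) (s, p)"
    and "B = partial_s (partial_p H) (s, p)" and "C = partial_p (partial_p H) (s, p)"
  have B: "partial_p (partial_s H) (s, p) = B"
    unfolding B_def by (rule partial_s_partial_p_commute[OF U(1) H U(2)])
  have lf: "lorentz_form H = (\<lambda>z. (partial_s H z)\<^sup>2
      + 2 * fst z / snd z * partial_s H z * partial_p H z + (partial_p H z)\<^sup>2)"
    by (auto simp: lorentz_form_def fun_eq_iff)
  have "(lorentz_form H has_derivative (\<lambda>v.
      2 * X * (fst v * A + snd v * B) + 2 * Y * (fst v * B + snd v * C)
      + 2 * (fst v / p - s * snd v / p\<^sup>2) * a * b)) (at (s, p))"
    unfolding lf using p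
    by (auto intro!: derivative_eq_intros da db
        simp: fun_eq_iff B a_def[symmetric] b_def[symmetric] A_def[symmetric] B_def[symmetric]
          C_def[symmetric] X_def Y_def field_simps power2_eq_square)
  moreover have "(lorentz_form H has_derivative (\<lambda>v. 0)) (at (s, p))"
    by (rule has_derivative_transform_within_open[OF _ U, where f = "\<lambda>_. 1"])
      (auto simp: eq)
  ultimately have "(\<lambda>v. 2 * X * (fst v * A + snd v * B) + 2 * Y * (fst v * B + snd v * C)
      + 2 * (fst v / p - s * snd v / p\<^sup>2) * a * b) = (\<lambda>v. 0)"
    by (rule has_derivative_unique)
  \<comment> \<open>These directions give the \<open>s\<close>- and \<open>p\<close>-derivatives of
    the constraint. Since \<open>B\<close> is both mixed derivatives, the sums can be read as
    derivatives of \<open>partial_s H\<close> and \<open>partial_p H\<close> along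
    \<open>(X, Y)\<close>.\<close>
  from fun_cong[OF this, of "(1, 0)"] fun_cong[OF this, of "(0, 1)"]
  have eqA: "2 * (X * A + Y * B) = 2 * - (a * b / p)"
    and eqB: "2 * (X * B + Y * C) = 2 * (s * a * b / p\<^sup>2)"
    by (simp_all add: algebra_simps)
  show "X * partial_s (partial_s H) (s, p) + Y * partial_p (partial_s H) (s, p) = - (a * b / p)"
    unfolding B A_def[symmetric] by (rule mult_left_cancel[THEN iffD1, OF _ eqA]) simp
  show "X * partial_s (partial_p H) (s, p) + Y * partial_p (partial_p H) (s, p) = s * a * b / p\<^sup>2"
    unfolding B_def[symmetric] C_def[symmetric] by (rule mult_left_cancel[THEN iffD1, OF _ eqB]) simp
qed

text \<open>Total derivatives are supplied, rather than partial ones, so that the chain rule through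
  \<open>f\<close> applies directly.\<close>

lemma tau_has_derivative_along_flow:
  fixes s p :: real
  assumes U: "open U" "(s, p) \<in> U" and p: "p \<noteq> 0"
    and H: "smooth_on U H" and eq: "\<And>z. z \<in> U \<Longrightarrow> lorentz_form H z = 1"
  defines "a \<equiv> partial_s H (s, p)" and "b \<equiv> partial_p H (s, p)"
  defines "v \<equiv> (a + s / p * b, s / p * a + b)"
  obtains T1 T2 where "(tau1 H has_derivative T1) (at (s, p))" "T1 v = 0"
    "(tau2 H has_derivative T2) (at (s, p))" "T2 v = 0"
proof -
  note sm = smooth_on_partials[OF U(1) H]
  define h where "h = H (s, p)"
  define H' Ha Hb where "H' = (\<lambda>v. fst v * partial_s H (s, p) + snd v * partial_p H (s, p))"
    and "Ha = (\<lambda>v. fst v * partial_s (partial_s H) (s, p) + snd v * partial_p (partial_s H) (s, p))"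
    and "Hb = (\<lambda>v. fst v * partial_s (partial_p H) (s, p) + snd v * partial_p (partial_p H) (s, p))"
  have dH: "(H has_derivative H') (at (s, p))"
    and dHa: "(partial_s H has_derivative Ha) (at (s, p))"
    and dHb: "(partial_p H has_derivative Hb) (at (s, p))"
    unfolding H'_def Ha_def Hb_def
    using has_derivative_partials smooth_on_imp_differentiable[OF _ U(2)] H sm by auto
  define X Y where "X = a + s / p * b" and "Y = s / p * a + b"
  have v: "v = (X, Y)" by (simp add: v_def X_def Y_def)
  \<comment> \<open>Denominators are cleared so that the final identity is polynomial.\<close>
  have pX: "p * X = p * a + s * b" and pY: "p * Y = s * a + p * b"
    using p by (simp_all add: X_def Y_def field_simps)
  have one: "X * a + Y * b = 1"
    using eq[OF U(2)] by (simp add: lorentz_form_def a_def b_def X_def Y_def power2_eq_square algebra_simps)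
  have H'v: "H' v = 1" using one by (simp add: H'_def v a_def b_def)
  have Hav: "p * Ha v = - (a * b)" and Hbv: "p\<^sup>2 * Hb v = s * a * b"
    using lorentz_flow_derivatives[OF U p H eq] p
    by (simp_all add: Ha_def Hb_def v_def a_def b_def)
  define T1 where "T1 w = 6 * (fst w * a + s * Ha w + snd w * b + p * Hb w - H' w)" for w
  define T2 where "T2 w = 12 * h * H' w - 4 * p * snd w
      - 12 * (snd w * h * b + p * H' w * b + p * h * Hb w)
      + 16 * p * b * (snd w * b + p * Hb w)
      + 4 * (fst w * a + s * Ha w) * (4 * p * b - 3 * h)
      + 4 * s * a * (4 * snd w * b + 4 * p * Hb w - 3 * H' w)
      - 8 * (p * snd w - 3 * s * fst w) * a\<^sup>2 - 8 * (p\<^sup>2 - 3 * s\<^sup>2) * a * Ha w" for w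
  have tau1: "tau1 H = (\<lambda>z. 6 * (fst z * partial_s H z + snd z * partial_p H z - H z))"
    by (auto simp: tau1_def fun_eq_iff)
  have tau2: "tau2 H = (\<lambda>z.
     6 * (H z)\<^sup>2 - 2 * (snd z)\<^sup>2 - 12 * snd z * H z * partial_p H z
     + 8 * (snd z)\<^sup>2 * (partial_p H z)\<^sup>2
     + 4 * fst z * partial_s H z * (4 * snd z * partial_p H z - 3 * H z)
     - 4 * ((snd z)\<^sup>2 - 3 * (fst z)\<^sup>2) * (partial_s H z)\<^sup>2)"
    by (auto simp: tau2_def fun_eq_iff)
  have "(tau1 H has_derivative T1) (at (s, p))"
    unfolding tau1
    by (auto intro!: derivative_eq_intros dH dHa dHb
        simp: fun_eq_iff T1_def a_def[symmetric] b_def[symmetric] algebra_simps)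
  moreover have "(tau2 H has_derivative T2) (at (s, p))"
    unfolding tau2
    by (auto intro!: derivative_eq_intros dH dHa dHb
        simp: fun_eq_iff T2_def a_def[symmetric] b_def[symmetric] h_def[symmetric]
          power2_eq_square algebra_simps)
  \<comment> \<open>The second-derivative terms of \<open>tau1\<close> cancel along
    \<open>v\<close>, leaving \<open>6 * (X * a + Y * b - H' v)\<close>, which is
    \<open>6 * (1 - 1)\<close>.\<close>
  moreover have sb: "s * Ha v + p * Hb v = 0"
  proof -
    have "p * (s * Ha v + p * Hb v) = s * (p * Ha v) + p\<^sup>2 * Hb v"
      by (simp add: algebra_simps power2_eq_square)
    thus ?thesis using Hav Hbv p by simp
  qed
  moreover have "T1 v = 0"
    using sb one H'v by (simp add: T1_def v algebra_simps)
  moreover have "T2 v = 0"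
  proof -
    \<comment> \<open>Using \<open>sb\<close>, \<open>one\<close> and \<open>H'v\<close>, the terms
      in \<open>h\<close> cancel and \<open>T2 v\<close> reduces to \<open>8 * a * ((s\<^sup>2 -
      p\<^sup>2) * Ha v + a * (s * X - p * Y))\<close>. The factor \<open>p\<close> then lets
      \<open>Hav\<close>, \<open>pX\<close> and \<open>pY\<close> finish.\<close>
    have "p * T2 v = 0"
      using Hav sb one pX pY H'v unfolding T2_def v fst_conv snd_conv by algebra
    thus ?thesis using p by simp
  qed
  ultimately show ?thesis using that by blast
qed

text \<open>Preservation to leading order is rendered pointwise as an \<open>O(l\<^sup>2)\<close>
  defect in the deformed equation. The defect is exactly quadratic in \<open>l\<close> once the
  linearised equation holds.\<close>

theorem mainTheorem2:
  fixes U V :: "(real \<times> real) set"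
    and H \<O> f :: "real \<times> real \<Rightarrow> real"
  assumes "open U"
    and "U \<subseteq> {(s, p). s > p \<and> p > 0}"
    and "smooth_on U H"
    and "\<And>s p. (s, p) \<in> U \<Longrightarrow> lorentz_form H (s, p) = 1"
    and "open V"
    and "\<And>s p. (s, p) \<in> U \<Longrightarrow> (tau1 H (s, p), tau2 H (s, p)) \<in> V"
    and "smooth_on V f"
    and "\<And>s p. (s, p) \<in> U \<Longrightarrow> \<O> (s, p) = f (tau1 H (s, p), tau2 H (s, p))"
  shows "(\<forall>(s, p)\<in>U.
           partial_s H (s, p) * partial_s \<O> (s, p)
           + s / p * (partial_p H (s, p) * partial_s \<O> (s, p)
                      + partial_s H (s, p) * partial_p \<O> (s, p))
           + partial_p H (s, p) * partial_p \<O> (s, p) = 0) \<and>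
         (\<forall>(s, p)\<in>U.
           (\<lambda>l::real. lorentz_form (\<lambda>z. H z + l * \<O> z) (s, p) - 1) \<in> O[at 0](\<lambda>l. l\<^sup>2))"
proof -
  have lin: "partial_s H (s, p) * partial_s \<O> (s, p)
      + s / p * (partial_p H (s, p) * partial_s \<O> (s, p)
                 + partial_s H (s, p) * partial_p \<O> (s, p))
      + partial_p H (s, p) * partial_p \<O> (s, p) = 0"
    and diff: "\<O> differentiable at (s, p)" if sp: "(s, p) \<in> U" for s p
  proof -
    define v where "v = (partial_s H (s, p) + s / p * partial_p H (s, p),
      s / p * partial_s H (s, p) + partial_p H (s, p))"
    have p: "p \<noteq> 0" using sp assms(2) by auto
    have eq: "lorentz_form H z = 1" if "z \<in> U" for z
      using assms(4) that by (cases z) auto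
    obtain T1 T2 where T: "(tau1 H has_derivative T1) (at (s, p))" "T1 v = 0"
      "(tau2 H has_derivative T2) (at (s, p))" "T2 v = 0"
      unfolding v_def by (rule tau_has_derivative_along_flow[OF assms(1) sp p assms(3) eq])
    obtain f' where f': "(f has_derivative f') (at (tau1 H (s, p), tau2 H (s, p)))"
      using smooth_on_imp_differentiable[OF assms(7) assms(6)[OF sp]]
      unfolding differentiable_def by blast
    have "((\<lambda>z. f (tau1 H z, tau2 H z)) has_derivative (\<lambda>w. f' (T1 w, T2 w))) (at (s, p))"
      using has_derivative_Pair[OF T(1,3)] f' by (rule has_derivative_compose)
    \<comment> \<open>\<open>\<O>\<close> is tied to \<open>f\<close> only on \<open>U\<close>;
      openness of \<open>U\<close> transfers the derivative.\<close>
    hence O': "(\<O> has_derivative (\<lambda>w. f' (T1 w, T2 w))) (at (s, p))"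
      by (rule has_derivative_transform_within_open[OF _ assms(1) sp]) (use assms(8) in auto)
    thus diff: "\<O> differentiable at (s, p)" unfolding differentiable_def by blast
    \<comment> \<open>Both derivatives of \<open>\<O>\<close> are evaluated at \<open>v\<close>: one
      side is the linearised form regrouped, the other is \<open>f' (0, 0)\<close>.\<close>
    have "f' (T1 v, T2 v) = fst v * partial_s \<O> (s, p) + snd v * partial_p \<O> (s, p)"
      using has_derivative_unique[OF O' has_derivative_partials[OF diff]] by metis
    moreover have "f' (0, 0) = 0"
      using linear_0[OF has_derivative_linear[OF f']] by (simp add: zero_prod_def)
    ultimately show "partial_s H (s, p) * partial_s \<O> (s, p)
      + s / p * (partial_p H (s, p) * partial_s \<O> (s, p)
                 + partial_s H (s, p) * partial_p \<O> (s, p))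
      + partial_p H (s, p) * partial_p \<O> (s, p) = 0"
      using T(2,4) by (simp add: v_def algebra_simps)
  qed
  moreover have "(\<lambda>l::real. lorentz_form (\<lambda>z. H z + l * \<O> z) (s, p) - 1) \<in> O[at 0](\<lambda>l. l\<^sup>2)"
    if sp: "(s, p) \<in> U" for s p
  proof -
    have "partial_s (\<lambda>z. H z + l * \<O> z) (s, p) = partial_s H (s, p) + l * partial_s \<O> (s, p)"
      "partial_p (\<lambda>z. H z + l * \<O> z) (s, p) = partial_p H (s, p) + l * partial_p \<O> (s, p)" for l
      using has_derivative_imp_partials[OF has_derivative_add[OF
            has_derivative_partials[OF smooth_on_imp_differentiable[OF assms(3) sp]]
            has_derivative_mult_right[OF has_derivative_partials[OF diff[OF sp]]]], of l]
      by simp_all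
    \<comment> \<open>An exact expansion: the coefficient of \<open>l\<close> is twice the
      linearised form, which vanishes by \<open>lin\<close>.\<close>
    hence "lorentz_form (\<lambda>z. H z + l * \<O> z) (s, p)
        = lorentz_form H (s, p) + 2 * l * (partial_s H (s, p) * partial_s \<O> (s, p)
           + s / p * (partial_p H (s, p) * partial_s \<O> (s, p)
                      + partial_s H (s, p) * partial_p \<O> (s, p))
           + partial_p H (s, p) * partial_p \<O> (s, p)) + lorentz_form \<O> (s, p) * l\<^sup>2" for l
      by (simp add: lorentz_form_def power2_eq_square algebra_simps add_divide_distrib)
    hence "(\<lambda>l. lorentz_form (\<lambda>z. H z + l * \<O> z) (s, p) - 1) = (\<lambda>l. lorentz_form \<O> (s, p) * l\<^sup>2)"
      unfolding lin[OF sp] assms(4)[OF sp] by simp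
    thus ?thesis by simp
  qed
  ultimately show ?thesis by blast
qed

end
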